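(* Let $k\ge 1$, $n\ge 1$, and let $f^1,\ldots,f^n:[0,1]^k\to\mathbb{R}$ be positive, monotone functions such that for every $i$ and every real $s\ge 0$ the upper level set $\{x\in[0,1]^k : f^i(x)>s\}$ is either empty or a $k$-rectangle (the rectangles are not assumed homothetic to one another). Then $E_n(f^1,\ldots,f^n)\ge 0$, where $[0,1]^k$ carries Lebesgue measure.
   Context: "Positive" means non-negative. $[0,1]^k$ is partially ordered by $x\le x'$ iff $x_i\le x_i'$ for all $i$, and $f$ is monotone (decreasing) if $x\le x'$ implies $f(x)\ge f(x')$. A $k$-rectangle is a subset of $[0,1]^k$ of the form $[0,r_1]\times\cdots\times[0,r_k]$ with $0\le r_1,\ldots,r_k\le 1$. Write $\mathcal{E}(f)=\int f$ for the integral with respect to Lebesgue measure. For $\sigma$ in the symmetric group $S_n$ with disjoint cycle decomposition $\sigma=(i_1,\ldots,i_p)(j_1,\ldots,j_q)\cdots$ (fixed points included as cycles of length 1), let $C_\sigma$ be the number of cycles and $$E_\sigma(f^1,\ldots,f^n)=\mathcal{E}(f^{i_1}\cdots f^{i_p})\,\mathcal{E}(f^{j_1}\cdots f^{j_q})\cdots .$$ Then $E_n(f^1,\ldots,f^n)=\sum_{\sigma\in S_n}(-1)^{C_\sigma-1}E_\sigma(f^1,\ldots,f^n)$. *)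

theory Defs
  imports "HOL-Analysis.Analysis" "HOL-Combinatorics.Orbits"
begin

text \<open>
  The dimension \<open>k\<close> is the cardinality of the finite index type \<open>'k\<close>, and the order on
  \<open>real ^ 'k\<close> is componentwise. Functions on the unit cube are represented by
  functions on \<open>real ^ 'k\<close> whose values outside the cube play no role.
\<close>

definition unit_cube :: "(real ^ 'k) set"
  where "unit_cube = {x. \<forall>j. 0 \<le> x $ j \<and> x $ j \<le> 1}"

definition k_rectangle :: "(real ^ 'k) set \<Rightarrow> bool"
  where "k_rectangle R \<longleftrightarrow>
    (\<exists>r. (\<forall>j. 0 \<le> r $ j \<and> r $ j \<le> 1) \<and> R = {x. \<forall>j. 0 \<le> x $ j \<and> x $ j \<le> r $ j})"

definition cube_integral :: "(real ^ 'k \<Rightarrow> real) \<Rightarrow> real"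
  where "cube_integral f = integral\<^sup>L (lebesgue_on unit_cube) f"

text \<open>
  A cycle enters only through its underlying set, since the functions along a cycle are
  multiplied pointwise. For a permutation these sets are its orbits, and a fixed
  point has itself as orbit.
\<close>

definition cycle_sets :: "nat \<Rightarrow> (nat \<Rightarrow> nat) \<Rightarrow> nat set set"
  where "cycle_sets n p = orbit p ` {1..n}"

definition E_perm :: "nat \<Rightarrow> (nat \<Rightarrow> nat) \<Rightarrow> (nat \<Rightarrow> real ^ 'k \<Rightarrow> real) \<Rightarrow> real"
  where "E_perm n p f = (\<Prod>c\<in>cycle_sets n p. cube_integral (\<lambda>x. \<Prod>i\<in>c. f i x))"

text \<open>
  The subtraction in the exponent is on \<open>nat\<close>; for \<open>n \<ge> 1\<close> there is at least one cycle,
  so it does not truncate.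
\<close>

definition E_sum :: "nat \<Rightarrow> (nat \<Rightarrow> real ^ 'k \<Rightarrow> real) \<Rightarrow> real"
  where "E_sum n f =
    (\<Sum>p | p permutes {1..n}. (-1) ^ (card (cycle_sets n p) - 1) * E_perm n p f)"

end

theory Submission
  imports Defs
begin

text \<open>
  For a set function \<open>u\<close> let \<open>X(u, S)\<close> be the sum over all permutations of \<open>S\<close> of the product of
  \<open>u\<close> over the cycles. With \<open>w(c)\<close> the integral of the product of the \<open>f\<^sup>i\<close>, \<open>i \<in> c\<close>, the sign
  \<open>(-1)\<close> to the number of cycles is absorbed by passing from \<open>w\<close> to \<open>-w\<close>, and the claim becomes
  \<open>X(-w, {1..n}) \<le> 0\<close>.

  The sum \<open>X\<close> behaves like an exponential in \<open>u\<close>: colouring every cycle of a permutation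
  by one of two colours splits the ground set into two invariant parts, so that \<open>X(u + v, S)\<close> is the
  sum of \<open>X(u, T) X(v, S - T)\<close> over all \<open>T \<subseteq> S\<close> (\<open>cycle_sum_add\<close>).

  For indicators of rectangles with side lengths \<open>r\<^sub>i\<^sub>j\<close> the weight \<open>w(c)\<close> is the product over the
  coordinates \<open>j\<close> of the minimum of \<open>r\<^sub>i\<^sub>j\<close> over \<open>i \<in> c\<close>, and the coordinates can be introduced
  one at a time. Suppose \<open>X(-w', T) \<le> 0\<close> for all nonempty \<open>T \<subseteq> S\<close>, and let
  \<open>w(c) = \<rho>(c) w'(c)\<close> where \<open>\<rho>(c)\<close> is the minimum of \<open>r\<^sub>i\<close> over \<open>i \<in> c\<close>. Let \<open>m \<in> S\<close> minimize \<open>r\<close>.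
  The unique cycle through \<open>m\<close> has weight \<open>-r\<^sub>m w'\<close>; for every other cycle write
  \<open>-w = -w' + (1 - \<rho>) w'\<close>. Pulling out the factor \<open>r\<^sub>m\<close> and expanding gives
  \<open>X(-w, S) = r\<^sub>m \<Sum>\<^sub>T X(-w', T) X(q, S - T)\<close>, where \<open>q = (1 - \<rho>) w'\<close> off \<open>m\<close> and \<open>q = 0\<close> on sets
  containing \<open>m\<close>. Only the \<open>T\<close> with \<open>m \<in> T\<close> contribute, and since \<open>q \<ge> 0\<close> (as \<open>r\<^sub>i \<le> 1\<close>) each contribution is a
  nonpositive number times a nonnegative one (\<open>cycle_sum_Min_weight_nonpos\<close>). The induction
  starts with the weight \<open>1\<close>, where \<open>X(-1, S)\<close> can be computed exactly.

  General functions are reduced to indicators of their upper level sets by the layer cake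
  formula: the sum is linear in each single function \<open>f\<^sup>i\<close>, and \<open>f\<^sup>i\<close> is the integral over
  \<open>s \<ge> 0\<close> of the indicators of \<open>{f\<^sup>i > s}\<close>.
\<close>

section \<open>Sums over permutations of products over cycles\<close>

text \<open>
  As in the definition of \<^const>\<open>E_perm\<close>, a cycle is represented by its underlying set. The
  weight \<open>u\<close> carries the sign.
\<close>

definition cycle_sum :: "('a set \<Rightarrow> real) \<Rightarrow> 'a set \<Rightarrow> real"
  where "cycle_sum u S = (\<Sum>p | p permutes S. \<Prod>c\<in>orbit p ` S. u c)"

lemma mem_orbit_iff:
  assumes "finite S" "p permutes S" "c \<in> orbit p ` S"
  shows "m \<in> c \<longleftrightarrow> c = orbit p m"
proof -
  have perm: "permutation p" using assms permutation_permutes by blast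
  obtain s where s: "c = orbit p s" using assms(3) by blast
  show ?thesis
    using orbit_cyclic_eq3[OF cyclic_on_orbit'[OF perm]] permutation_self_in_orbit[OF perm]
    unfolding s by metis
qed

lemma Union_orbits:
  assumes "finite S" "p permutes S"
  shows "\<Union> (orbit p ` S) = S"
proof -
  have "permutation p" using assms permutation_permutes by blast
  then have "s \<in> orbit p s" for s by (rule permutation_self_in_orbit)
  then show ?thesis
    using permutes_orbit_subset[OF assms(2)] by auto
qed

lemma orbit_comp_disjoint:
  assumes "finite S" "p permutes S" "finite T" "q permutes T" "S \<inter> T = {}"
  shows "x \<in> S \<Longrightarrow> orbit (p \<circ> q) x = orbit p x" "x \<in> T \<Longrightarrow> orbit (p \<circ> q) x = orbit q x"
proof -
  have pS: "p y \<in> S" if "y \<in> S" for y using that assms(2) permutes_in_image by metis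
  have qT: "q y \<in> T" if "y \<in> T" for y using that assms(4) permutes_in_image by metis
  have q_id: "q y = y" if "y \<in> S" for y
    using that assms(4,5) permutes_not_in by fastforce
  have p_id: "p y = y" if "y \<in> T" for y
    using that assms(2,5) permutes_not_in by fastforce
  show "orbit (p \<circ> q) x = orbit p x" if "x \<in> S"
    by (rule orbit_cong0[of x S]) (use that q_id pS in auto)
  show "orbit (p \<circ> q) x = orbit q x" if "x \<in> T"
    by (rule orbit_cong0[of x T]) (use that p_id qT in auto)
qed

lemma perm_restrict_invariant:
  assumes "finite S" "p permutes S" "T \<subseteq> S" and inv: "\<And>x. x \<in> T \<Longrightarrow> p x \<in> T"
  shows "perm_restrict p T permutes T"
    and "x \<in> T \<Longrightarrow> orbit (perm_restrict p T) x = orbit p x"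
proof -
  have "inj_on p T" using assms(2) permutes_inj_on by blast
  then have "bij_betw p T T"
    using endo_inj_surj[of T p] inv assms(1,3) finite_subset
    by (metis bij_betw_def image_subsetI)
  then have "bij_betw (perm_restrict p T) T T"
    by (simp add: bij_betw_cong[of T "perm_restrict p T" p] perm_restrict_def)
  then show "perm_restrict p T permutes T"
    by (rule bij_imp_permutes) (simp add: perm_restrict_def)
  show "orbit (perm_restrict p T) x = orbit p x" if "x \<in> T"
    by (rule orbit_cong0[of x T]) (use that inv in \<open>auto simp: perm_restrict_def\<close>)
qed

text \<open>
  A set of cycles is the same thing as an invariant subset of the ground set. This is what makes
  colourings of the cycles correspond to splittings of the permutation.
\<close>

lemma Union_of_orbits:
  assumes "finite S" "p permutes S" "B \<subseteq> orbit p ` S"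
  shows "\<Union>B \<subseteq> S" "x \<in> \<Union>B \<Longrightarrow> p x \<in> \<Union>B" "x \<in> S - \<Union>B \<Longrightarrow> p x \<in> S - \<Union>B"
    "orbit p ` \<Union>B = B" "orbit p ` (S - \<Union>B) = orbit p ` S - B"
proof -
  have perm: "permutation p" using assms permutation_permutes by blast
  have mem: "x \<in> c \<longleftrightarrow> c = orbit p x" if "c \<in> B" for c x
    using mem_orbit_iff[OF assms(1,2)] that assms(3) by blast
  have mem_Union: "x \<in> \<Union>B \<longleftrightarrow> orbit p x \<in> B" for x
  proof
    assume "x \<in> \<Union>B"
    then obtain c where "c \<in> B" "x \<in> c" by blast
    then show "orbit p x \<in> B" using mem by simp
  next
    assume "orbit p x \<in> B"
    then show "x \<in> \<Union>B" using permutation_self_in_orbit[OF perm] by blast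
  qed
  show "\<Union>B \<subseteq> S" using assms(3) Union_orbits[OF assms(1,2)] by blast
  show "x \<in> \<Union>B \<Longrightarrow> p x \<in> \<Union>B"
    unfolding mem_Union permutation_orbit_step[OF perm] .
  show "x \<in> S - \<Union>B \<Longrightarrow> p x \<in> S - \<Union>B"
    unfolding Diff_iff mem_Union permutation_orbit_step[OF perm] permutes_in_image[OF assms(2)] .
  show "orbit p ` \<Union>B = B"
  proof
    show "orbit p ` \<Union>B \<subseteq> B" unfolding image_subset_iff mem_Union[symmetric] by simp
    show "B \<subseteq> orbit p ` \<Union>B"
    proof
      fix c assume c: "c \<in> B"
      then obtain s where s: "c = orbit p s" using assms(3) by blast
      then have "s \<in> \<Union>B" unfolding mem_Union using c by simp
      then show "c \<in> orbit p ` \<Union>B" unfolding s by (rule imageI)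
    qed
  qed
  have "S - \<Union>B = {x \<in> S. orbit p x \<notin> B}"
    unfolding set_eq_iff Diff_iff mem_Union by simp
  then show "orbit p ` (S - \<Union>B) = orbit p ` S - B" by auto
qed

text \<open>
  Expanding the product over the cycles of \<open>p\<close> chooses a set \<open>B\<close> of cycles that receive \<open>u\<close>, the
  others receiving \<open>v\<close>. The pairs \<open>(p, B)\<close> correspond bijectively to the triples \<open>(T, p\<^sub>1, p\<^sub>2)\<close> of
  a subset \<open>T\<close>, a permutation of \<open>T\<close> and one of \<open>S - T\<close>: take \<open>T = \<Union>B\<close> and restrict \<open>p\<close>;
  conversely compose \<open>p\<^sub>1\<close> and \<open>p\<^sub>2\<close>.
\<close>

lemma cycle_sum_add:
  fixes u v :: "'a set \<Rightarrow> real"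
  assumes S: "finite S"
  shows "cycle_sum (\<lambda>c. u c + v c) S = (\<Sum>T\<in>Pow S. cycle_sum u T * cycle_sum v (S - T))"
proof -
  define f where "f = (\<lambda>(p, B). (\<Prod>c\<in>B. u c) * (\<Prod>c\<in>orbit p ` S - B. v c))"
  define g where "g = (\<lambda>(T, p, q). (\<Prod>c\<in>orbit p ` T. u c) * (\<Prod>c\<in>orbit q ` (S - T). v c))"
  define X where "X = (SIGMA p : {p. p permutes S}. Pow (orbit p ` S))"
  define Y where "Y = (SIGMA T : Pow S. {p. p permutes T} \<times> {q. q permutes (S - T)})"
  have fin_perm: "finite {p. p permutes T}" if "T \<subseteq> S" for T
    using that S finite_subset finite_permutations by blast
  have "cycle_sum (\<lambda>c. u c + v c) S
      = (\<Sum>p | p permutes S. \<Sum>B\<in>Pow (orbit p ` S). (\<Prod>c\<in>B. u c) * (\<Prod>c\<in>orbit p ` S - B. v c))"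
    unfolding cycle_sum_def by (intro sum.cong refl prod_add) (use S in auto)
  also have "\<dots> = sum f X"
    unfolding X_def f_def by (rule sum.Sigma) (use fin_perm S in auto)
  also have "\<dots> = sum g Y"
  proof (rule sum.reindex_bij_witness[where
        i = "\<lambda>(T, p, q). (p \<circ> q, orbit p ` T)" and
        j = "\<lambda>(p, B). (\<Union>B, perm_restrict p (\<Union>B), perm_restrict p (S - \<Union>B))"])
    fix a assume "a \<in> X"
    then obtain p B where a: "a = (p, B)" and p: "p permutes S" and B: "B \<subseteq> orbit p ` S"
      unfolding X_def by auto
    note U = Union_of_orbits[OF S p B]
    note R1 = perm_restrict_invariant[OF S p U(1) U(2)]
    note R2 = perm_restrict_invariant[OF S p Diff_subset U(3)]
    have orb1: "orbit (perm_restrict p (\<Union>B)) ` \<Union>B = B"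
      using R1(2) U(4) by (metis (no_types, lifting) image_cong)
    have orb2: "orbit (perm_restrict p (S - \<Union>B)) ` (S - \<Union>B) = orbit p ` S - B"
      using R2(2) U(5) by (metis (no_types, lifting) image_cong)
    have "perm_restrict p (\<Union>B) \<circ> perm_restrict p (S - \<Union>B) = perm_restrict p (\<Union>B \<union> (S - \<Union>B))"
      by (rule perm_restrict_union[OF R1(1) R2(1)]) auto
    also have "\<Union>B \<union> (S - \<Union>B) = S" using U(1) by blast
    finally have comp: "perm_restrict p (\<Union>B) \<circ> perm_restrict p (S - \<Union>B) = p"
      unfolding perm_restrict_id[OF p] .
    show "(case case a of (p, B) \<Rightarrow> (\<Union>B, perm_restrict p (\<Union>B), perm_restrict p (S - \<Union>B)) of
        (T, p, q) \<Rightarrow> (p \<circ> q, orbit p ` T)) = a"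
      unfolding a prod.case comp orb1 ..
    show "(case a of (p, B) \<Rightarrow> (\<Union>B, perm_restrict p (\<Union>B), perm_restrict p (S - \<Union>B))) \<in> Y"
      unfolding a Y_def prod.case using U(1) R1(1) R2(1) by auto
    show "g (case a of (p, B) \<Rightarrow> (\<Union>B, perm_restrict p (\<Union>B), perm_restrict p (S - \<Union>B))) = f a"
      unfolding a g_def f_def prod.case orb1 orb2 ..
  next
    fix b assume "b \<in> Y"
    then obtain T p q where b: "b = (T, p, q)" and T: "T \<subseteq> S"
      and p: "p permutes T" and q: "q permutes (S - T)"
      unfolding Y_def by auto
    have finT: "finite T" and finD: "finite (S - T)" using T S finite_subset by auto
    have disj: "T \<inter> (S - T) = {}" by blast
    note O = orbit_comp_disjoint[OF finT p finD q disj]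
    have un: "\<Union> (orbit p ` T) = T" by (rule Union_orbits[OF finT p])
    have r1: "perm_restrict (p \<circ> q) T = p"
    proof
      fix x show "perm_restrict (p \<circ> q) T x = p x"
        using permutes_not_in[OF q, of x] permutes_not_in[OF p, of x]
        by (auto simp: perm_restrict_def)
    qed
    have r2: "perm_restrict (p \<circ> q) (S - T) = q"
    proof
      fix x show "perm_restrict (p \<circ> q) (S - T) x = q x"
        using permutes_not_in[OF q, of x] permutes_not_in[OF p, of "q x"] permutes_in_image[OF q, of x]
        by (auto simp: perm_restrict_def)
    qed
    show "(case case b of (T, p, q) \<Rightarrow> (p \<circ> q, orbit p ` T) of
        (p, B) \<Rightarrow> (\<Union>B, perm_restrict p (\<Union>B), perm_restrict p (S - \<Union>B))) = b"
      unfolding b prod.case un r1 r2 ..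
    have "p \<circ> q permutes S"
      using permutes_compose[OF permutes_subset[OF q] permutes_subset[OF p T]] by blast
    moreover have "orbit p ` T \<subseteq> orbit (p \<circ> q) ` S"
      using O(1) T by (metis image_cong image_mono)
    ultimately show "(case b of (T, p, q) \<Rightarrow> (p \<circ> q, orbit p ` T)) \<in> X"
      unfolding b X_def by auto
  qed
  also have "\<dots> = (\<Sum>T\<in>Pow S. \<Sum>(p, q)\<in>{p. p permutes T} \<times> {q. q permutes (S - T)}.
      (\<Prod>c\<in>orbit p ` T. u c) * (\<Prod>c\<in>orbit q ` (S - T). v c))"
    unfolding Y_def g_def
    by (subst sum.Sigma) (use fin_perm S in \<open>auto simp: case_prod_beta\<close>)
  also have "\<dots> = (\<Sum>T\<in>Pow S. cycle_sum u T * cycle_sum v (S - T))"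
    unfolding cycle_sum_def by (simp add: sum_product sum.cartesian_product)
  finally show ?thesis .
qed

lemma cycle_sum_empty [simp]: "cycle_sum u {} = 1"
  by (simp add: cycle_sum_def)

lemma cycle_sum_nonneg:
  assumes "\<And>c. c \<subseteq> S \<Longrightarrow> c \<noteq> {} \<Longrightarrow> u c \<ge> 0" "finite S"
  shows "cycle_sum u S \<ge> 0"
  unfolding cycle_sum_def
proof (intro sum_nonneg prod_nonneg ballI)
  fix p c assume "p \<in> {p. p permutes S}" "c \<in> orbit p ` S"
  then have "c \<subseteq> S" "c \<noteq> {}"
    by (auto simp: orbit_nonempty dest: permutes_orbit_subset)
  then show "u c \<ge> 0" by (rule assms(1))
qed

lemma cycle_sum_cong:
  assumes "\<And>c. c \<subseteq> S \<Longrightarrow> c \<noteq> {} \<Longrightarrow> u c = v c"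
  shows "cycle_sum u S = cycle_sum v S"
  unfolding cycle_sum_def
proof (intro sum.cong prod.cong refl)
  fix p c assume "p \<in> {p. p permutes S}" "c \<in> orbit p ` S"
  then have "c \<subseteq> S" "c \<noteq> {}"
    by (auto simp: orbit_nonempty dest: permutes_orbit_subset)
  then show "u c = v c" by (rule assms(1))
qed

lemma cycle_sum_vanish:
  assumes "finite S" "m \<in> S" "\<And>c. m \<in> c \<Longrightarrow> u c = 0"
  shows "cycle_sum u S = 0"
  unfolding cycle_sum_def
proof (intro sum.neutral ballI)
  fix p assume p: "p \<in> {p. p permutes S}"
  then have "permutation p" using assms(1) permutation_permutes by blast
  then have "m \<in> orbit p m" by (rule permutation_self_in_orbit)
  then have "u (orbit p m) = 0" by (rule assms(3))
  then show "(\<Prod>c\<in>orbit p ` S. u c) = 0"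
    using assms(1,2) by (intro prod_zero) auto
qed

text \<open>
  In every permutation exactly one cycle passes through \<open>m\<close>.
\<close>

lemma cycle_sum_scale_at:
  assumes "finite S" "m \<in> S"
  shows "cycle_sum (\<lambda>c. (if m \<in> c then r else 1) * u c) S = r * cycle_sum u S"
  unfolding cycle_sum_def sum_distrib_left
proof (intro sum.cong refl)
  fix p assume "p \<in> {p. p permutes S}"
  then have p: "p permutes S" by simp
  have "(\<Prod>c\<in>orbit p ` S. if m \<in> c then r else 1) = (\<Prod>c\<in>orbit p ` S. if c = orbit p m then r else 1)"
    by (intro prod.cong refl) (simp add: mem_orbit_iff[OF assms(1) p])
  also have "\<dots> = r" using assms by simp
  finally show "(\<Prod>c\<in>orbit p ` S. (if m \<in> c then r else 1) * u c) = r * (\<Prod>c\<in>orbit p ` S. u c)"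
    by (simp add: prod.distrib)
qed

lemma cycle_sum_one: "finite S \<Longrightarrow> cycle_sum (\<lambda>_. 1) S = fact (card S)"
  by (simp add: cycle_sum_def card_permutations)

text \<open>
  The exponential rule for \<open>0 = -1 + 1\<close> says that \<open>S \<mapsto> X(-1, S)\<close> is the convolution inverse of
  \<open>S \<mapsto> |S|!\<close>. In terms of exponential generating functions it is the inverse \<open>1 - t\<close> of the
  geometric series, which explains the values. The induction on \<open>S\<close> isolates the term \<open>T = S\<close>.
\<close>

lemma cycle_sum_minus_one:
  assumes "finite S"
  shows "cycle_sum (\<lambda>_. -1) S = (if S = {} then 1 else if card S = 1 then -1 else 0)"
  using assms
proof (induction S rule: finite_psubset_induct)
  case (psubset S)
  let ?h = "\<lambda>S. cycle_sum (\<lambda>_. -1) S"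
  show ?case
  proof (cases "S = {}")
    case False
    define N where "N = card {T \<in> Pow S - {S}. card T = 1}"
    have "0 = cycle_sum (\<lambda>_. 0) S"
      using False psubset.hyps cycle_sum_vanish[of S _ "\<lambda>_. 0"] by auto
    also have "\<dots> = (\<Sum>T\<in>Pow S. ?h T * fact (card (S - T)))"
      using cycle_sum_add[OF psubset.hyps(1), of "\<lambda>_. -1" "\<lambda>_. 1"] psubset.hyps(1)
      by (simp add: cycle_sum_one)
    also have "\<dots> = ?h S + (\<Sum>T\<in>Pow S - {S}. ?h T * fact (card (S - T)))"
      using psubset.hyps(1) by (subst sum.remove[of _ S]) auto
    \<comment> \<open>By the induction hypothesis only the empty set and the \<open>N\<close> proper singletons contribute.\<close>
    also have "(\<Sum>T\<in>Pow S - {S}. ?h T * fact (card (S - T)))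
        = (\<Sum>T\<in>Pow S - {S}. (if T = {} then fact (card S) else 0)
            - (if card T = 1 then fact (card S - 1) else 0))"
    proof (intro sum.cong refl)
      fix T assume T: "T \<in> Pow S - {S}"
      then have "card (S - T) = card S - card T"
        using psubset.hyps(1) by (intro card_Diff_subset) (auto intro: finite_subset)
      then show "?h T * fact (card (S - T)) = (if T = {} then fact (card S) else 0)
            - (if card T = 1 then fact (card S - 1) else 0)"
        using psubset.IH[of T] T by (simp add: psubset_eq)
    qed
    also have "\<dots> = fact (card S) - real (card {T \<in> Pow S - {S}. card T = 1}) * fact (card S - 1)"
    proof -
      have fin: "finite (Pow S - {S})" using psubset.hyps(1) by simp
      have "(\<Sum>T\<in>Pow S - {S}. if T = {} then fact (card S) else 0) = (fact (card S) :: real)"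
        using fin False by simp
      moreover have "(\<Sum>T\<in>Pow S - {S}. if card T = 1 then fact (card S - 1) else 0)
          = real (card {T \<in> Pow S - {S}. card T = 1}) * fact (card S - 1)"
        unfolding sum.inter_filter[OF fin, symmetric] by simp
      ultimately show ?thesis unfolding sum_subtractf by simp
    qed
    finally have eq: "?h S = real N * fact (card S - 1) - fact (card S)"
      unfolding N_def by linarith
    show ?thesis
    proof (cases "card S = 1")
      case True
      then have none: "{T \<in> Pow S - {S}. card T = 1} = {}"
        using psubset.hyps(1) card_subset_eq[of S] by auto
      have "N = 0" unfolding N_def none by simp
      then show ?thesis using eq True False by simp
    next
      case not1: False
      then have all: "{T \<in> Pow S - {S}. card T = 1} = {T. T \<subseteq> S \<and> card T = 1}" by auto
      have "N = card S"
        unfolding N_def all using n_subsets[OF psubset.hyps(1), of 1] by simp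
      moreover have "fact (card S) = real (card S) * fact (card S - 1)"
        using False psubset.hyps(1) by (intro fact_reduce) (simp add: card_gt_0_iff)
      ultimately have "?h S = 0" using eq by simp
      then show ?thesis using False not1 by simp
    qed
  qed simp
qed

section \<open>Multiplying the weight by a minimum over the cycle\<close>

text \<open>
  The minimum over a cycle through a minimizer \<open>m\<close> of \<open>r\<close> on \<open>S\<close> is \<open>r m\<close>, a
  constant that factors out; on the other cycles the new weight differs from the old one by
  the nonnegative amount \<open>(1 - Min (r ` c)) * w c\<close>, and the exponential rule separates the two.
\<close>

lemma cycle_sum_Min_weight_nonpos:
  fixes r :: "'a \<Rightarrow> real"
  assumes S: "finite S" "S \<noteq> {}"
    and r: "\<And>i. i \<in> S \<Longrightarrow> 0 \<le> r i \<and> r i \<le> 1"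
    and w: "\<And>c. c \<subseteq> S \<Longrightarrow> c \<noteq> {} \<Longrightarrow> w c \<ge> 0"
    and nonpos: "\<And>T. T \<subseteq> S \<Longrightarrow> T \<noteq> {} \<Longrightarrow> cycle_sum (\<lambda>c. - w c) T \<le> 0"
  shows "cycle_sum (\<lambda>c. - (Min (r ` c) * w c)) S \<le> 0"
proof -
  have "Min (r ` S) \<in> r ` S" using S by (intro Min_in) auto
  then obtain m where m: "m \<in> S" "r m = Min (r ` S)" by (metis imageE)
  define q where "q c = (if m \<in> c then 0 else (1 - Min (r ` c)) * w c)" for c
  have Min01: "0 \<le> Min (r ` c) \<and> Min (r ` c) \<le> 1" if "c \<subseteq> S" "c \<noteq> {}" for c
  proof -
    have "finite c" using that(1) S(1) by (rule finite_subset)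
    then have "Min (r ` c) \<in> r ` c" using that(2) by (intro Min_in) auto
    then show ?thesis using r that(1) by auto
  qed
  have Min_m: "Min (r ` c) = r m" if "m \<in> c" "c \<subseteq> S" for c
  proof (rule Min_eqI)
    show "finite (r ` c)" using that(2) S(1) finite_subset by blast
    show "r m \<le> y" if "y \<in> r ` c" for y
      using that \<open>c \<subseteq> S\<close> m(2) S(1) by auto
    show "r m \<in> r ` c" using that(1) by (rule imageI)
  qed
  \<comment> \<open>On sets containing \<open>m\<close> the correction \<open>q\<close> vanishes, as the factor \<open>r m\<close> is taken out there.\<close>
  have "cycle_sum (\<lambda>c. - (Min (r ` c) * w c)) S
      = cycle_sum (\<lambda>c. (if m \<in> c then r m else 1) * (- w c + q c)) S"
    by (intro cycle_sum_cong) (auto simp: q_def Min_m algebra_simps)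
  also have "\<dots> = r m * (\<Sum>T\<in>Pow S. cycle_sum (\<lambda>c. - w c) T * cycle_sum q (S - T))"
    by (simp only: cycle_sum_scale_at[OF S(1) m(1)] cycle_sum_add[OF S(1)])
  also have "\<dots> \<le> 0"
  proof (rule mult_nonneg_nonpos)
    show "0 \<le> r m" using r m by blast
    show "(\<Sum>T\<in>Pow S. cycle_sum (\<lambda>c. - w c) T * cycle_sum q (S - T)) \<le> 0"
    proof (rule sum_nonpos)
      fix T assume "T \<in> Pow S"
      then have T: "T \<subseteq> S" by simp
      show "cycle_sum (\<lambda>c. - w c) T * cycle_sum q (S - T) \<le> 0"
      proof (cases "m \<in> T")
        case True
        have "cycle_sum q (S - T) \<ge> 0"
        proof (rule cycle_sum_nonneg)
          fix c assume "c \<subseteq> S - T" "c \<noteq> {}"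
          then have "c \<subseteq> S" "c \<noteq> {}" by auto
          then show "q c \<ge> 0" using w Min01 unfolding q_def by auto
        qed (use S(1) in simp)
        moreover have "cycle_sum (\<lambda>c. - w c) T \<le> 0" using nonpos[OF T] True by auto
        ultimately show ?thesis by (intro mult_nonpos_nonneg)
      next
        case False
        then have "cycle_sum q (S - T) = 0"
          using m S(1) by (intro cycle_sum_vanish[of _ m]) (auto simp: q_def)
        then show ?thesis by simp
      qed
    qed
  qed
  finally show ?thesis .
qed

text \<open>
  The weight is the volume of the intersection of the boxes with side lengths \<open>r i j\<close>. Induction
  on the set of coordinates; without coordinates the weight is \<open>1\<close>.
\<close>

lemma cycle_sum_box_volume_nonpos:
  fixes r :: "'a \<Rightarrow> 'j \<Rightarrow> real"
  assumes "finite J" "finite S" "S \<noteq> {}"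
    and "\<And>i j. i \<in> S \<Longrightarrow> j \<in> J \<Longrightarrow> 0 \<le> r i j \<and> r i j \<le> 1"
  shows "cycle_sum (\<lambda>c. - (\<Prod>j\<in>J. Min ((\<lambda>i. r i j) ` c))) S \<le> 0"
  using assms
proof (induction J arbitrary: S rule: finite_induct)
  case empty
  then show ?case by (simp add: cycle_sum_minus_one)
next
  case (insert a J)
  have pos: "(\<Prod>j\<in>J. Min ((\<lambda>i. r i j) ` c)) \<ge> 0" if "c \<subseteq> S" "c \<noteq> {}" for c
  proof (intro prod_nonneg ballI)
    fix j assume "j \<in> J"
    then show "0 \<le> Min ((\<lambda>i. r i j) ` c)"
      using that insert.prems finite_subset[of c S] by (subst Min_ge_iff) auto
  qed
  have IH: "cycle_sum (\<lambda>c. - (\<Prod>j\<in>J. Min ((\<lambda>i. r i j) ` c))) T \<le> 0" if "T \<subseteq> S" "T \<noteq> {}" for T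
    by (rule insert.IH) (use that insert.prems in \<open>auto intro: finite_subset\<close>)
  show ?case
    using cycle_sum_Min_weight_nonpos[of S "\<lambda>i. r i a", OF _ _ _ pos IH] insert by simp
qed

section \<open>Layer cake reduction to level sets\<close>

text \<open>
  On a finite measure space this class consists of integrable functions and is closed
  under products, so that all integrals below exist.
\<close>

definition bounded_measurable :: "'a measure \<Rightarrow> ('a \<Rightarrow> real) \<Rightarrow> bool"
  where "bounded_measurable M f \<longleftrightarrow>
    f \<in> borel_measurable M \<and> (\<exists>B. \<forall>x\<in>space M. \<bar>f x\<bar> \<le> B)"

lemma bounded_measurable_integrable:
  assumes "finite_measure M" "bounded_measurable M f"
  shows "integrable M f"
proof -
  obtain B where "f \<in> borel_measurable M" "\<forall>x\<in>space M. \<bar>f x\<bar> \<le> B"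
    using assms(2) unfolding bounded_measurable_def by blast
  then show ?thesis
    by (intro finite_measure.integrable_const_bound[OF assms(1), of f B]) (auto intro!: AE_I2)
qed

lemma bounded_measurable_const: "bounded_measurable M (\<lambda>_. a)"
  unfolding bounded_measurable_def by auto

lemma bounded_measurable_add:
  assumes "bounded_measurable M f" "bounded_measurable M g"
  shows "bounded_measurable M (\<lambda>x. f x + g x)"
proof -
  obtain A B where "\<forall>x\<in>space M. \<bar>f x\<bar> \<le> A" "\<forall>x\<in>space M. \<bar>g x\<bar> \<le> B"
    using assms unfolding bounded_measurable_def by blast
  then have "\<forall>x\<in>space M. \<bar>f x + g x\<bar> \<le> A + B"
    by (meson abs_triangle_ineq add_mono order_trans)
  then show ?thesis using assms unfolding bounded_measurable_def by auto
qed

lemma bounded_measurable_mult: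
  assumes "bounded_measurable M f" "bounded_measurable M g"
  shows "bounded_measurable M (\<lambda>x. f x * g x)"
proof -
  obtain A B where A: "\<forall>x\<in>space M. \<bar>f x\<bar> \<le> A" and B: "\<forall>x\<in>space M. \<bar>g x\<bar> \<le> B"
    using assms unfolding bounded_measurable_def by blast
  have "\<bar>f x * g x\<bar> \<le> A * B" if "x \<in> space M" for x
  proof -
    have "\<bar>f x\<bar> \<le> A" "\<bar>g x\<bar> \<le> B" using A B that by auto
    moreover have "0 \<le> A" using \<open>\<bar>f x\<bar> \<le> A\<close> by linarith
    ultimately show ?thesis unfolding abs_mult by (intro mult_mono) auto
  qed
  then show ?thesis using assms unfolding bounded_measurable_def by auto
qed

lemma bounded_measurable_prod:
  assumes "finite A" "\<And>i. i \<in> A \<Longrightarrow> bounded_measurable M (f i)"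
  shows "bounded_measurable M (\<lambda>x. \<Prod>i\<in>A. f i x)"
  using assms
  by (induction rule: finite_induct) (simp_all add: bounded_measurable_const bounded_measurable_mult)

lemma bounded_measurable_sum:
  assumes "finite A" "\<And>i. i \<in> A \<Longrightarrow> bounded_measurable M (f i)"
  shows "bounded_measurable M (\<lambda>x. \<Sum>i\<in>A. f i x)"
  using assms
  by (induction rule: finite_induct) (simp_all add: bounded_measurable_const bounded_measurable_add)

lemma bounded_measurable_level:
  assumes "bounded_measurable M f"
  shows "bounded_measurable M (\<lambda>x. of_bool (s < f x))"
proof -
  have [measurable]: "f \<in> borel_measurable M"
    using assms unfolding bounded_measurable_def by blast
  show ?thesis
    unfolding bounded_measurable_def by (auto intro!: exI[of _ 1])
qed

text \<open>
  For \<open>x\<close> fixed, \<open>f x\<close> is the length of \<open>{s \<ge> 0. s < f x}\<close>; by Fubini the integral of \<open>f K\<close> is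
  an integral over \<open>s\<close> of the integrals in the hypothesis. The kernel \<open>K\<close> has no sign, so the
  exchange needs integrability, which holds because \<open>s\<close> can be confined to \<open>[0, B]\<close>.
\<close>

lemma layer_cake_nonpos:
  fixes f K :: "'a \<Rightarrow> real"
  assumes M: "finite_measure M"
    and f: "bounded_measurable M f" and f_nonneg: "\<And>x. x \<in> space M \<Longrightarrow> f x \<ge> 0"
    and K: "bounded_measurable M K"
    and levels: "\<And>s. s \<ge> 0 \<Longrightarrow> (\<integral>x. of_bool (s < f x) * K x \<partial>M) \<le> 0"
  shows "(\<integral>x. f x * K x \<partial>M) \<le> 0"
proof -
  obtain B C where B: "\<And>x. x \<in> space M \<Longrightarrow> \<bar>f x\<bar> \<le> B" and C: "\<And>x. x \<in> space M \<Longrightarrow> \<bar>K x\<bar> \<le> C"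
    using f K unfolding bounded_measurable_def by blast
  have [measurable]: "f \<in> borel_measurable M" "K \<in> borel_measurable M"
    using f K unfolding bounded_measurable_def by auto
  define N where "N = restrict_space lborel {0..B}"
  have [measurable]: "(\<lambda>s. s) \<in> borel_measurable N"
    unfolding N_def by (rule measurable_restrict_space1) simp
  have N: "finite_measure N"
    by (rule finite_measureI)
      (simp add: N_def emeasure_restrict_space space_restrict_space emeasure_lborel_Icc_eq)
  interpret pair_sigma_finite M N
    using M N by (intro pair_sigma_finite.intro finite_measure.axioms)
  have "finite_measure (M \<Otimes>\<^sub>M N)"
    using finite_measure_pair_measure[OF N M] .
  then have int: "integrable (M \<Otimes>\<^sub>M N) (\<lambda>(x, s). of_bool (s < f x) * K x)"
    by (rule finite_measure.integrable_const_bound[where B = C])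
      (auto intro!: AE_I2 simp: space_pair_measure intro: C order_trans[OF abs_ge_zero C])
  have layer: "(\<integral>s. of_bool (s < f x) * K x \<partial>N) = f x * K x" if x: "x \<in> space M" for x
  proof -
    have "(\<integral>s. of_bool (s < f x) * K x \<partial>N) = (\<integral>s. of_bool (s < f x) \<partial>N) * K x"
      by (rule integral_mult_left_zero)
    also have "(\<integral>s. of_bool (s < f x) \<partial>N) = (\<integral>s. indicator {0..<f x} s \<partial>lborel :: real)"
    proof -
      have "indicator {0..B} s *\<^sub>R of_bool (s < f x) = (indicator {0..<f x} s :: real)" for s
        using B[OF x] by (auto simp: indicator_def)
      then show ?thesis
        unfolding N_def by (subst integral_restrict_space) simp_all
    qed
    also have "\<dots> = f x" using f_nonneg[OF x] by simp
    finally show ?thesis .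
  qed
  have "(\<integral>x. f x * K x \<partial>M) = (\<integral>x. (\<integral>s. of_bool (s < f x) * K x \<partial>N) \<partial>M)"
    by (rule Bochner_Integration.integral_cong) (simp_all only: layer)
  also have "\<dots> = (\<integral>s. (\<integral>x. of_bool (s < f x) * K x \<partial>M) \<partial>N)"
    by (rule Fubini_integral[symmetric, OF int])
  also have "\<dots> \<le> (\<integral>s. 0 \<partial>N)"
  proof (rule integral_mono)
    show "integrable N (\<lambda>s. \<integral>x. of_bool (s < f x) * K x \<partial>M)"
      by (rule integrable_snd[OF int])
    show "(\<integral>x. of_bool (s < f x) * K x \<partial>M) \<le> 0" if "s \<in> space N" for s
      using that by (intro levels) (simp add: N_def space_restrict_space)
  qed simp
  finally show ?thesis by simp
qed

text \<open>
  This is \<open>-E\<^sub>n\<close> of the family \<open>f\<close> on a general measure space, with the sign of the permutation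
  sum moved into the weights of the cycles.
\<close>

definition cycle_correlation :: "'a measure \<Rightarrow> 'i set \<Rightarrow> ('i \<Rightarrow> 'a \<Rightarrow> real) \<Rightarrow> real"
  where "cycle_correlation M S f = cycle_sum (\<lambda>c. - (\<integral>x. (\<Prod>i\<in>c. f i x) \<partial>M)) S"

text \<open>
  The function with index \<open>i\<close> enters each term exactly once, through the cycle that passes through
  \<open>i\<close>. Hence the whole sum is a linear functional of it, given by integration against a bounded
  kernel built from the other functions.
\<close>

lemma cycle_correlation_kernel:
  assumes M: "finite_measure M" and S: "finite S" "i \<in> S"
    and g: "\<And>l. l \<in> S \<Longrightarrow> bounded_measurable M (g l)"
  obtains K where "bounded_measurable M K"
    "\<And>h. bounded_measurable M h \<Longrightarrow> cycle_correlation M S (g(i := h)) = (\<integral>x. h x * K x \<partial>M)"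
proof -
  define w where "w g c = - (\<integral>x. (\<Prod>l\<in>c. g l x) \<partial>M)" for g :: "'b \<Rightarrow> 'a \<Rightarrow> real" and c
  define A where "A p = - (\<Prod>c\<in>orbit p ` S - {orbit p i}. w g c)" for p
  define P where "P p x = (\<Prod>l\<in>orbit p i - {i}. g l x)" for p x
  define K where "K x = (\<Sum>p | p permutes S. A p * P p x)" for x
  have P: "bounded_measurable M (P p)" if "p permutes S" for p
  proof -
    have "orbit p i \<subseteq> S" using permutes_orbit_subset[OF that S(2)] .
    then show ?thesis
      unfolding P_def using S(1) g by (intro bounded_measurable_prod) (auto intro: finite_subset)
  qed
  have K: "bounded_measurable M K"
    unfolding K_def using S(1) P
    by (intro bounded_measurable_sum bounded_measurable_mult bounded_measurable_const)
      (auto simp: finite_permutations)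
  have "cycle_correlation M S (g(i := h)) = (\<integral>x. h x * K x \<partial>M)" if h: "bounded_measurable M h" for h
  proof -
    have "(\<Prod>c\<in>orbit p ` S. w (g(i := h)) c) = A p * (\<integral>x. h x * P p x \<partial>M)"
      if "p permutes S" for p
    proof -
      have orb: "finite (orbit p i)" "i \<in> orbit p i"
        using that S(1) permutation_permutes permutation_self_in_orbit finite_orbit by metis+
      have "(\<Prod>l\<in>orbit p i. (g(i := h)) l x) = h x * P p x" for x
        unfolding P_def by (subst prod.remove[OF orb]) simp
      then have "w (g(i := h)) (orbit p i) = - (\<integral>x. h x * P p x \<partial>M)"
        unfolding w_def by simp
      moreover have "w (g(i := h)) c = w g c" if "c \<in> orbit p ` S - {orbit p i}" for c
      proof -
        have "i \<notin> c" using that mem_orbit_iff[OF S(1) \<open>p permutes S\<close>, of c i] by blast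
        then have "(\<Prod>l\<in>c. (g(i := h)) l x) = (\<Prod>l\<in>c. g l x)" for x
          by (intro prod.cong) auto
        then show ?thesis unfolding w_def by simp
      qed
      ultimately show ?thesis
        unfolding A_def using S by (subst prod.remove[of _ "orbit p i"]) auto
    qed
    then have "cycle_correlation M S (g(i := h)) = (\<Sum>p | p permutes S. A p * (\<integral>x. h x * P p x \<partial>M))"
      unfolding cycle_correlation_def cycle_sum_def w_def by (intro sum.cong) auto
    also have "\<dots> = (\<Sum>p | p permutes S. (\<integral>x. A p * (h x * P p x) \<partial>M))"
      by simp
    also have "\<dots> = (\<integral>x. (\<Sum>p | p permutes S. A p * (h x * P p x)) \<partial>M)"
      using P h
      by (intro Bochner_Integration.integral_sum[symmetric] bounded_measurable_integrable[OF M]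
          bounded_measurable_mult bounded_measurable_const) auto
    also have "\<dots> = (\<integral>x. h x * K x \<partial>M)"
      unfolding K_def sum_distrib_left by (simp add: mult_ac)
    finally show ?thesis .
  qed
  then show thesis using K that by blast
qed

text \<open>
  The functions are replaced by indicators of level sets one index at a time: \<open>mix J s\<close> still has
  the original functions on \<open>J\<close> and level indicators elsewhere. For each \<open>j\<close> the sum is linear in
  the \<open>j\<close>-th function, so the layer cake formula applies to it.
\<close>

lemma cycle_correlation_nonpos_of_levels:
  fixes f :: "'i \<Rightarrow> 'a \<Rightarrow> real"
  assumes M: "finite_measure M" and S: "finite S"
    and f: "\<And>i. i \<in> S \<Longrightarrow> bounded_measurable M (f i)"
    and f_nonneg: "\<And>i x. i \<in> S \<Longrightarrow> x \<in> space M \<Longrightarrow> f i x \<ge> 0"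
    and levels: "\<And>s. (\<And>i. s i \<ge> 0) \<Longrightarrow> cycle_correlation M S (\<lambda>i x. of_bool (s i < f i x)) \<le> 0"
  shows "cycle_correlation M S f \<le> 0"
proof -
  define mix where "mix J s i = (if i \<in> J then f i else (\<lambda>x. of_bool (s i < f i x)))" for J s i
  have "\<forall>s. (\<forall>i. s i \<ge> 0) \<longrightarrow> cycle_correlation M S (mix J s) \<le> 0" if "finite J" "J \<subseteq> S" for J
    using that
  proof (induction J rule: finite_induct)
    case empty
    then show ?case using levels unfolding mix_def by simp
  next
    case (insert j J)
    show ?case
    proof (intro allI impI)
      fix s :: "'i \<Rightarrow> real" assume s: "\<forall>i. s i \<ge> 0"
      have j: "j \<in> S" using insert.prems by blast
      have "bounded_measurable M (mix J s i)" if "i \<in> S" for i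
        unfolding mix_def using f[OF that] bounded_measurable_level by auto
      then obtain K where K: "bounded_measurable M K"
        and corr: "\<And>h. bounded_measurable M h \<Longrightarrow>
          cycle_correlation M S ((mix J s)(j := h)) = (\<integral>x. h x * K x \<partial>M)"
        using cycle_correlation_kernel[OF M S j, of "mix J s"] by blast
      have "(\<integral>x. f j x * K x \<partial>M) \<le> 0"
      proof (rule layer_cake_nonpos[OF M f[OF j] f_nonneg[OF j] K])
        fix t :: real assume "t \<ge> 0"
        then have "cycle_correlation M S (mix J (s(j := t))) \<le> 0"
          using insert s by simp
        also have "mix J (s(j := t)) = (mix J s)(j := (\<lambda>x. of_bool (t < f j x)))"
          using insert.hyps unfolding mix_def by (auto simp: fun_eq_iff)
        finally show "(\<integral>x. of_bool (t < f j x) * K x \<partial>M) \<le> 0"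
          unfolding corr[OF bounded_measurable_level[OF f[OF j]]] .
      qed
      also have "(\<integral>x. f j x * K x \<partial>M) = cycle_correlation M S ((mix J s)(j := f j))"
        by (rule corr[OF f[OF j], symmetric])
      also have "(mix J s)(j := f j) = mix (insert j J) s"
        unfolding mix_def by (auto simp: fun_eq_iff)
      finally show "cycle_correlation M S (mix (insert j J) s) \<le> 0" .
    qed
  qed
  from this[OF S subset_refl] have "cycle_correlation M S (mix S (\<lambda>_. 0)) \<le> 0" by simp
  also have "cycle_correlation M S (mix S (\<lambda>_. 0)) = cycle_correlation M S f"
    unfolding cycle_correlation_def
  proof (rule cycle_sum_cong)
    fix c assume "c \<subseteq> S"
    then have "(\<Prod>i\<in>c. mix S (\<lambda>_. 0) i x) = (\<Prod>i\<in>c. f i x)" for x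
      unfolding mix_def by (intro prod.cong) auto
    then show "- (\<integral>x. (\<Prod>i\<in>c. mix S (\<lambda>_. 0) i x) \<partial>M) = - (\<integral>x. (\<Prod>i\<in>c. f i x) \<partial>M)" by simp
  qed
  finally show ?thesis .
qed

section \<open>Rectangles in the unit cube\<close>

lemma unit_cube_cbox: "unit_cube = cbox 0 1"
  by (auto simp: unit_cube_def mem_box_cart)

lemma k_rectangle_lebesgue:
  assumes "k_rectangle R"
  shows "R \<in> sets (lebesgue_on unit_cube)"
proof -
  obtain r where r: "\<forall>j. 0 \<le> r $ j \<and> r $ j \<le> 1" and R: "R = {x. \<forall>j. 0 \<le> x $ j \<and> x $ j \<le> r $ j}"
    using assms unfolding k_rectangle_def by blast
  have "R = cbox 0 r" unfolding R by (auto simp: mem_box_cart)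
  moreover have "R \<subseteq> unit_cube"
  proof
    fix x assume "x \<in> R"
    then have "0 \<le> x $ j" "x $ j \<le> r $ j" "r $ j \<le> 1" for j using r R by auto
    then show "x \<in> unit_cube" unfolding unit_cube_def using order_trans by blast
  qed
  ultimately show ?thesis
    by (simp add: sets_restrict_space_iff unit_cube_cbox)
qed

lemma cube_integral_prod_rectangles:
  fixes r :: "'i \<Rightarrow> real ^ 'k" and A :: "'i \<Rightarrow> (real ^ 'k) set"
  assumes c: "finite c" "c \<noteq> {}"
    and r: "\<And>i j. i \<in> c \<Longrightarrow> 0 \<le> r i $ j \<and> r i $ j \<le> 1"
    and A: "\<And>i. i \<in> c \<Longrightarrow> A i = {x. \<forall>j. 0 \<le> x $ j \<and> x $ j \<le> r i $ j}"
  shows "(\<integral>x. (\<Prod>i\<in>c. of_bool (x \<in> A i)) \<partial>lebesgue_on unit_cube)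
    = (\<Prod>j\<in>UNIV. Min ((\<lambda>i. r i $ j) ` c))"
proof -
  define m :: "real ^ 'k" where "m = (\<chi> j. Min ((\<lambda>i. r i $ j) ` c))"
  have m_nonneg: "0 \<le> m $ j" for j
    unfolding m_def using c r by (simp add: Min_ge_iff)
  have le_m: "y \<le> m $ j \<longleftrightarrow> (\<forall>i\<in>c. y \<le> r i $ j)" for y j
    unfolding m_def using c by (simp add: Min_ge_iff)
  have m_le: "m $ j \<le> 1" for j
    using le_m[of "m $ j" j] r c by (meson all_not_in_conv order_refl order_trans)
  have ind: "(\<Prod>i\<in>c. of_bool (x \<in> A i)) = (indicator (cbox 0 m) x :: real)" for x
  proof -
    have "(\<forall>i\<in>c. x \<in> A i) \<longleftrightarrow> x \<in> cbox 0 m"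
      using c(2) by (auto simp: A mem_box_cart le_m)
    moreover have "(\<Prod>i\<in>c. of_bool (x \<in> A i)) = (of_bool (\<forall>i\<in>c. x \<in> A i) :: real)"
      using c(1) by (induction rule: finite_induct) auto
    ultimately show ?thesis by (simp add: indicator_def)
  qed
  have sub: "cbox 0 m \<subseteq> unit_cube"
  proof
    fix x assume "x \<in> cbox 0 m"
    then have "0 \<le> x $ j" "x $ j \<le> m $ j" for j by (auto simp: mem_box_cart)
    then show "x \<in> unit_cube"
      unfolding unit_cube_def using order_trans[OF _ m_le] by blast
  qed
  have "(\<integral>x. (\<Prod>i\<in>c. of_bool (x \<in> A i)) \<partial>lebesgue_on unit_cube)
      = measure (lebesgue_on unit_cube) (cbox 0 m \<inter> unit_cube)"
    unfolding ind by simp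
  also have "\<dots> = measure lebesgue (cbox 0 m)"
    using sub by (subst measure_restrict_space) (auto simp: unit_cube_cbox Int_absorb2)
  also have "\<dots> = (\<Prod>j\<in>UNIV. m $ j)"
  proof -
    have "cbox 0 m \<noteq> {}" using m_nonneg by (simp add: interval_ne_empty_cart)
    then show ?thesis by (simp add: measure_completion content_cbox_cart)
  qed
  finally show ?thesis unfolding m_def by simp
qed

text \<open>
  An empty set among the \<open>A i\<close> kills the cycle through its index, hence every term. Otherwise the
  weight of a cycle is the volume of an intersection of boxes.
\<close>

lemma cycle_correlation_rectangles_nonpos:
  fixes A :: "'i \<Rightarrow> (real ^ 'k) set"
  assumes S: "finite S" "S \<noteq> {}"
    and A: "\<And>i. i \<in> S \<Longrightarrow> A i = {} \<or> k_rectangle (A i)"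
  shows "cycle_correlation (lebesgue_on unit_cube) S (\<lambda>i x. of_bool (x \<in> A i)) \<le> 0"
proof (cases "\<exists>m\<in>S. A m = {}")
  case True
  then obtain m where m: "m \<in> S" "A m = {}" by blast
  have "cycle_correlation (lebesgue_on unit_cube) S (\<lambda>i x. of_bool (x \<in> A i))
      = cycle_sum (\<lambda>c. if m \<in> c then 0 else
          - (\<integral>x. (\<Prod>i\<in>c. of_bool (x \<in> A i)) \<partial>lebesgue_on unit_cube)) S"
    unfolding cycle_correlation_def
  proof (intro cycle_sum_cong)
    fix c assume "c \<subseteq> S"
    then have fin: "finite c" using S(1) by (rule finite_subset)
    have zero: "(\<Prod>i\<in>c. of_bool (x \<in> A i)) = (0 :: real)" if "m \<in> c" for x
      using fin that m(2) by (intro prod_zero) auto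
    show "- (\<integral>x. (\<Prod>i\<in>c. of_bool (x \<in> A i) :: real) \<partial>lebesgue_on unit_cube)
        = (if m \<in> c then 0 else - (\<integral>x. (\<Prod>i\<in>c. of_bool (x \<in> A i)) \<partial>lebesgue_on unit_cube))"
    proof (cases "m \<in> c")
      case True
      have "(\<integral>x. (\<Prod>i\<in>c. of_bool (x \<in> A i)) \<partial>lebesgue_on unit_cube)
          = (\<integral>x. (0 :: real) \<partial>lebesgue_on (unit_cube :: (real ^ 'k) set))"
        by (intro Bochner_Integration.integral_cong refl zero[OF True])
      then show ?thesis using True by simp
    qed simp
  qed
  also have "\<dots> = 0" using S(1) m(1) by (rule cycle_sum_vanish) simp
  finally show ?thesis by simp
next
  case False
  then have "\<forall>i\<in>S. k_rectangle (A i)" using A by blast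
  then have "\<forall>i\<in>S. \<exists>r. (\<forall>j. 0 \<le> r $ j \<and> r $ j \<le> 1) \<and> A i = {x. \<forall>j. 0 \<le> x $ j \<and> x $ j \<le> r $ j}"
    unfolding k_rectangle_def .
  from bchoice[OF this] obtain r where
    r_box: "\<forall>i\<in>S. (\<forall>j. 0 \<le> r i $ j \<and> r i $ j \<le> 1) \<and> A i = {x. \<forall>j. 0 \<le> x $ j \<and> x $ j \<le> r i $ j}" ..
  have r: "0 \<le> r i $ j \<and> r i $ j \<le> 1" if "i \<in> S" for i j
    using r_box that by blast
  have A_eq: "A i = {x. \<forall>j. 0 \<le> x $ j \<and> x $ j \<le> r i $ j}" if "i \<in> S" for i
    using r_box that by blast
  have "cycle_correlation (lebesgue_on unit_cube) S (\<lambda>i x. of_bool (x \<in> A i))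
      = cycle_sum (\<lambda>c. - (\<Prod>j\<in>UNIV. Min ((\<lambda>i. r i $ j) ` c))) S"
    unfolding cycle_correlation_def
  proof (intro cycle_sum_cong)
    fix c assume c: "c \<subseteq> S" "c \<noteq> {}"
    then have "finite c" using S(1) finite_subset by blast
    then have "(\<integral>x. (\<Prod>i\<in>c. of_bool (x \<in> A i)) \<partial>lebesgue_on unit_cube)
        = (\<Prod>j\<in>UNIV. Min ((\<lambda>i. r i $ j) ` c))"
      by (rule cube_integral_prod_rectangles) (use c r A_eq in blast)+
    then show "- (\<integral>x. (\<Prod>i\<in>c. of_bool (x \<in> A i)) \<partial>lebesgue_on unit_cube)
        = - (\<Prod>j\<in>UNIV. Min ((\<lambda>i. r i $ j) ` c))" by simp
  qed
  also have "\<dots> \<le> 0"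
    using S r by (intro cycle_sum_box_volume_nonpos) auto
  finally show ?thesis .
qed

lemma E_sum_eq:
  assumes "n \<ge> 1"
  shows "E_sum n f = - cycle_correlation (lebesgue_on unit_cube) {1..n} f"
proof -
  have "(-1) ^ (card (cycle_sets n p) - 1) * E_perm n p f
      = - (\<Prod>c\<in>orbit p ` {1..n}. - (\<integral>x. (\<Prod>i\<in>c. f i x) \<partial>lebesgue_on unit_cube))" for p
  proof -
    have "cycle_sets n p \<noteq> {}" "finite (cycle_sets n p)"
      using assms by (auto simp: cycle_sets_def)
    then obtain C where "card (cycle_sets n p) = Suc C"
      by (metis card_eq_0_iff not0_implies_Suc)
    then show ?thesis
      unfolding prod_uminus E_perm_def cube_integral_def by (simp add: cycle_sets_def)
  qed
  then show ?thesis
    unfolding E_sum_def cycle_correlation_def cycle_sum_def by (simp add: sum_negf)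
qed

text \<open>
  Measurability comes from the level sets: those with \<open>s < 0\<close> are the whole cube. The bound is the
  value at the origin, the least point of the cube.
\<close>

lemma cube_function_bounded_measurable:
  fixes f :: "real ^ 'k \<Rightarrow> real"
  assumes nonneg: "\<And>x. x \<in> unit_cube \<Longrightarrow> f x \<ge> 0"
    and anti: "antimono_on unit_cube f"
    and levels: "\<And>s. s \<ge> 0 \<Longrightarrow> {x \<in> unit_cube. f x > s} = {} \<or> k_rectangle {x \<in> unit_cube. f x > s}"
  shows "bounded_measurable (lebesgue_on unit_cube) f"
proof -
  have "{x \<in> unit_cube. s < f x} \<in> sets (lebesgue_on unit_cube)" for s
  proof (cases "s \<ge> 0")
    case True
    from levels[OF this] show ?thesis
    proof
      assume "{x \<in> unit_cube. s < f x} = {}"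
      then show ?thesis by (simp only: sets.empty_sets)
    qed (rule k_rectangle_lebesgue)
  next
    case False
    then have "{x \<in> unit_cube. s < f x} = space (lebesgue_on unit_cube)"
      using nonneg by fastforce
    then show ?thesis by (metis sets.top)
  qed
  then have "f \<in> borel_measurable (lebesgue_on unit_cube)"
    by (simp add: borel_measurable_iff_greater)
  moreover have "\<bar>f x\<bar> \<le> f 0" if "x \<in> unit_cube" for x
  proof -
    have "0 \<in> unit_cube" "0 \<le> x" using that by (auto simp: unit_cube_def less_eq_vec_def)
    then have "f x \<le> f 0" using anti that by (auto simp: monotone_on_def)
    then show ?thesis using nonneg[OF that] by simp
  qed
  ultimately show ?thesis unfolding bounded_measurable_def by auto
qed

theorem corollary3p6:
  fixes n :: nat and f :: "nat \<Rightarrow> real ^ 'k \<Rightarrow> real"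
  assumes "n \<ge> 1"
    and "\<And>i x. i \<in> {1..n} \<Longrightarrow> x \<in> unit_cube \<Longrightarrow> f i x \<ge> 0"
    and "\<And>i. i \<in> {1..n} \<Longrightarrow> antimono_on unit_cube (f i)"
    and "\<And>i s. i \<in> {1..n} \<Longrightarrow> s \<ge> 0 \<Longrightarrow>
      {x \<in> unit_cube. f i x > s} = {} \<or> k_rectangle {x \<in> unit_cube. f i x > s}"
  shows "E_sum n f \<ge> 0"
proof -
  let ?M = "lebesgue_on unit_cube :: (real ^ 'k) measure"
  have M: "finite_measure ?M"
    unfolding unit_cube_cbox by (intro finite_measure_lebesgue_on lmeasurable_cbox)
  have "cycle_correlation ?M {1..n} f \<le> 0"
  proof (rule cycle_correlation_nonpos_of_levels[OF M])
    show "bounded_measurable ?M (f i)" if "i \<in> {1..n}" for i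
      by (rule cube_function_bounded_measurable) (use that assms in auto)
    show "f i x \<ge> 0" if "i \<in> {1..n}" "x \<in> space ?M" for i x
      using that assms(2) by simp
  next
    fix s :: "nat \<Rightarrow> real" assume s: "\<And>i. s i \<ge> 0"
    define A where "A i = {x \<in> unit_cube. f i x > s i}" for i
    have "cycle_correlation ?M {1..n} (\<lambda>i x. of_bool (s i < f i x))
        = cycle_correlation ?M {1..n} (\<lambda>i x. of_bool (x \<in> A i))"
      unfolding cycle_correlation_def A_def
      by (intro cycle_sum_cong arg_cong[where f = uminus] Bochner_Integration.integral_cong refl prod.cong)
        auto
    also have "\<dots> \<le> 0"
      using assms(1,4) s unfolding A_def by (intro cycle_correlation_rectangles_nonpos) auto
    finally show "cycle_correlation ?M {1..n} (\<lambda>i x. of_bool (s i < f i x)) \<le> 0" .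
  qed simp
  then show ?thesis unfolding E_sum_eq[OF assms(1)] by simp
qed

end
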